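(* Let $\bar\epsilon\in\mathrm{int}(\mathcal{E})$ be such that $\{\bar\epsilon\}$ is a singleton invariancy set. If there is a strictly complementary optimal solution $(x^*(\bar\epsilon);y^*(\bar\epsilon);s^*(\bar\epsilon))$ at $\bar\epsilon$ and both set-valued mappings $\mathcal{P}^*(\epsilon)$ and $\mathcal{D}^*(\epsilon)$ are continuous at $\bar\epsilon$ relative to $\mathrm{int}(\mathcal{E})$, then $\bar\epsilon$ belongs to a nonlinearity interval.
   Context: Setting. Let $\mathbb{L}^{n_i}_+=\{x^i\in\mathbb{R}^{n_i}: x^i_1\ge\|x^i_{2:n_i}\|\}$ ($\|\cdot\|$ the $\ell_2$ norm), with interior $\mathrm{int}(\mathbb{L}^{n_i}_+)=\{x^i: x^i_1>\|x^i_{2:n_i}\|\}$ and boundary $\mathrm{bd}(\mathbb{L}^{n_i}_+)=\{x^i: x^i_1=\|x^i_{2:n_i}\|\}$. Let $\mathcal{L}^{\bar n}_+=\mathbb{L}^{n_1}_+\times\cdots\times\mathbb{L}^{n_p}_+$, $\bar n=\sum_{i=1}^p n_i$. Data: $A=(A^1,\ldots,A^p)\in\mathbb{R}^{m\times\bar n}$ with $A^i\in\mathbb{R}^{m\times n_i}$, $b\in\mathbb{R}^m$, $c,\bar c\in\mathbb{R}^{\bar n}$, $\bar c\ne0$ fixed. For $\epsilon\in\mathbb{R}$ consider $(\mathrm{P}_\epsilon)$: $\inf_x\{(c+\epsilon\bar c)^Tx: Ax=b,\ x\in\mathcal{L}^{\bar n}_+\}$ and $(\mathrm{D}_\epsilon)$: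 $\sup_{(y;s)}\{b^Ty: A^Ty+s=c+\epsilon\bar c,\ s\in\mathcal{L}^{\bar n}_+\}$, with vectors partitioned as $x=(x^1;\ldots;x^p)$, $s=(s^1;\ldots;s^p)$. Standing assumptions: $A$ has full row rank, and at $\epsilon=0$ there is a feasible $(x;y;s)$ of $(\mathrm{P}_0)$ and $(\mathrm{D}_0)$ with $x^i,s^i\in\mathrm{int}(\mathbb{L}^{n_i}_+)$ for all $i$. $\psi(\epsilon)\in\mathbb{R}\cup\{\pm\infty\}$ is the optimal value of $(\mathrm{P}_\epsilon)$; $\mathcal{E}=\{\epsilon:\psi(\epsilon)\in\mathbb{R}\}$, which is a non-singleton closed interval. The optimal sets are $\mathcal{P}^*(\epsilon)=\{x\in\mathcal{L}^{\bar n}_+: Ax=b,\ (c+\epsilon\bar c)^Tx=\psi(\epsilon)\}$ and $\mathcal{D}^*(\epsilon)=\{(y;s): s\in\mathcal{L}^{\bar n}_+,\ A^Ty+s=c+\epsilon\bar c,\ b^Ty=\psi(\epsilon)\}$; they are nonempty and compact for $\epsilon\in\mathrm{int}(\mathcal{E})$. Optimal partition. $\mathcal{B}(\epsilon)=\{i:\exists x\in\mathcal{P}^*(\epsilon),\ x^i\in\mathrm{int}(\mathbb{L}^{n_i}_+)\}$; $\mathcal{N}(\epsilon)=\{i:\exists (y;s)\in\mathcal{D}^*(\epsilon),\ s^i\in\mathrm{int}(\mathbb{L}^{n_i}_+)\}$; $\mathcal{R}(\epsilon)=\{i:\exists (x;y;s)\in\mathcal{P}^*(\epsilon)\times\mathcal{D}^*(\epsilon),\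 x^i,s^i\in\mathrm{bd}(\mathbb{L}^{n_i}_+)\setminus\{0\}\}$; $\mathcal{T}(\epsilon)=\{1,\ldots,p\}\setminus(\mathcal{B}(\epsilon)\cup\mathcal{N}(\epsilon)\cup\mathcal{R}(\epsilon))$. $\mathcal{T}(\epsilon)$ is further partitioned into $\mathcal{T}_1(\epsilon)=\{i\in\mathcal{T}(\epsilon): x^i=s^i=0\ \forall (x;y;s)\in\mathcal{P}^*(\epsilon)\times\mathcal{D}^*(\epsilon)\}$; $\mathcal{T}_2(\epsilon)=\{i\in\mathcal{T}(\epsilon):\exists x\in\mathcal{P}^*(\epsilon),\ x^i\in\mathrm{bd}(\mathbb{L}^{n_i}_+)\setminus\{0\}$, and $s^i=0\ \forall (y;s)\in\mathcal{D}^*(\epsilon)\}$; $\mathcal{T}_3(\epsilon)=\{i\in\mathcal{T}(\epsilon):\exists (y;s)\in\mathcal{D}^*(\epsilon),\ s^i\in\mathrm{bd}(\mathbb{L}^{n_i}_+)\setminus\{0\}$, and $x^i=0\ \forall x\in\mathcal{P}^*(\epsilon)\}$. The optimal partition is $\pi(\epsilon)=\{\mathcal{B}(\epsilon),\mathcal{N}(\epsilon),\mathcal{R}(\epsilon),\mathcal{T}(\epsilon)\}$ with $\mathcal{T}(\epsilon)=\{\mathcal{T}_1(\epsilon),\mathcal{T}_2(\epsilon),\mathcal{T}_3(\epsilon)\}$; equality of optimal partitions means equality of all these index sets. Maximally complementary optimal solution at $\epsilon$: $(x^*(\epsilon);y^*(\epsilon);s^*(\epsilon))$ with $x^*(\epsilon)$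 in the relative interior of $\mathcal{P}^*(\epsilon)$ and $(y^*(\epsilon);s^*(\epsilon))$ in the relative interior of $\mathcal{D}^*(\epsilon)$. Strictly complementary optimal solution at $\epsilon$: an element of $\mathcal{P}^*(\epsilon)\times\mathcal{D}^*(\epsilon)$ with $x^*(\epsilon)+s^*(\epsilon)\in\mathrm{int}(\mathcal{L}^{\bar n}_+)$. Write $\mathbb{R}_+x=\{\zeta x:\zeta\ge0\}$. Invariancy set: a maximal subset $\mathcal{E}_{\mathrm{inv}}$ of $\mathrm{int}(\mathcal{E})$ such that $\pi(\epsilon')=\pi(\epsilon'')$ for all $\epsilon',\epsilon''\in\mathcal{E}_{\mathrm{inv}}$ and the rays $\mathbb{R}_+x^{*i}(\epsilon)$ for $i\in\mathcal{R}(\epsilon)\cup\mathcal{T}_2(\epsilon)$ and $\mathbb{R}_+s^{*i}(\epsilon)$ for $i\in\mathcal{R}(\epsilon)\cup\mathcal{T}_3(\epsilon)$ do not vary with $\epsilon\in\mathcal{E}_{\mathrm{inv}}$, where $(x^*(\epsilon);y^*(\epsilon);s^*(\epsilon))$ is any maximally complementary optimal solution at $\epsilon$ (the rays do not depend on this choice). Nonlinearity interval: a non-singleton open maximal subinterval $\mathcal{E}_{\mathrm{non}}$ of $\mathrm{int}(\mathcal{E})$ such that $\pi(\epsilon')=\pi(\epsilon'')$ for all $\epsilon',\epsilon''\in\mathcal{E}_{\mathrm{non}}$, while $\mathbb{R}_+x^{*i}(\epsilon)$ for some $i\in\mathcal{R}(\epsilon)\cup\mathcal{T}_2(\epsilon)$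 or $\mathbb{R}_+s^{*i}(\epsilon)$ for some $i\in\mathcal{R}(\epsilon)\cup\mathcal{T}_3(\epsilon)$ varies with $\epsilon$. Continuity (Painlevé–Kuratowski). A set-valued mapping $\Phi$ is continuous at $\bar\epsilon$ relative to $\Gamma\ni\bar\epsilon$ if it is outer semicontinuous ($x_k\in\Phi(\epsilon_k)$, $\epsilon_k\in\Gamma$, $\epsilon_k\to\bar\epsilon$, $x_k\to x$ imply $x\in\Phi(\bar\epsilon)$) and inner semicontinuous (for every $x\in\Phi(\bar\epsilon)$ and every sequence $\epsilon_k\in\Gamma$ with $\epsilon_k\to\bar\epsilon$ there exist $x_k\in\Phi(\epsilon_k)$ with $x_k\to x$). *)

theory Defs
  imports "HOL-Analysis.Analysis"
begin

text \<open>
  A parametric second-order cone program in dimension \<open>CARD('n)\<close> with \<open>CARD('m)\<close> equality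
  constraints and \<open>CARD('p)\<close> cone blocks.  Instead of an ordered concatenation
  \<open>x = (x^1; ...; x^p)\<close>, the coordinates are distributed to the blocks by \<open>blk\<close>: the coordinates of
  \<open>x^i\<close> are the \<open>j\<close> with \<open>blk P j = i\<close>, and among them \<open>lead P i\<close> is the distinguished first one.
  The sizes \<open>n_i\<close> of the blocks are arbitrary positive numbers.
\<close>

record ('n, 'm, 'p) socp =
  coef_mat :: "real ^ 'n ^ 'm"
  rhs :: "real ^ 'm"
  cost :: "real ^ 'n"
  pert :: "real ^ 'n"
  blk :: "'n \<Rightarrow> 'p"
  lead :: "'p \<Rightarrow> 'n"

definition block_structure :: "('n::finite, 'm::finite, 'p::finite) socp \<Rightarrow> bool" where
  "block_structure P \<longleftrightarrow> (\<forall>i. blk P (lead P i) = i)"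

text \<open>The block \<open>x^i\<close>, padded with zeros outside its own coordinates.\<close>

definition block :: "('n::finite, 'm::finite, 'p::finite) socp \<Rightarrow> 'p \<Rightarrow> real ^ 'n \<Rightarrow> real ^ 'n" where
  "block P i x = (\<chi> j. if blk P j = i then x $ j else 0)"

definition block_tail :: "('n::finite, 'm::finite, 'p::finite) socp \<Rightarrow> 'p \<Rightarrow> real ^ 'n \<Rightarrow> real ^ 'n" where
  "block_tail P i v = (\<chi> j. if blk P j = i \<and> j \<noteq> lead P i then v $ j else 0)"

text \<open>
  The second-order cone of the \<open>i\<close>-th block, its interior and its boundary in \<open>\<real>^{n_i}\<close> (not in the
  ambient space).  These sets are only ever applied to padded blocks.
\<close>

definition soc :: "('n::finite, 'm::finite, 'p::finite) socp \<Rightarrow> 'p \<Rightarrow> (real ^ 'n) set" where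
  "soc P i = {v. v $ lead P i \<ge> norm (block_tail P i v)}"

definition soc_int :: "('n::finite, 'm::finite, 'p::finite) socp \<Rightarrow> 'p \<Rightarrow> (real ^ 'n) set" where
  "soc_int P i = {v. v $ lead P i > norm (block_tail P i v)}"

definition soc_bd :: "('n::finite, 'm::finite, 'p::finite) socp \<Rightarrow> 'p \<Rightarrow> (real ^ 'n) set" where
  "soc_bd P i = {v. v $ lead P i = norm (block_tail P i v)}"

definition soc_prod :: "('n::finite, 'm::finite, 'p::finite) socp \<Rightarrow> (real ^ 'n) set" where
  "soc_prod P = {x. \<forall>i. block P i x \<in> soc P i}"

definition obj :: "('n::finite, 'm::finite, 'p::finite) socp \<Rightarrow> real \<Rightarrow> real ^ 'n" where
  "obj P \<epsilon> = cost P + \<epsilon> *\<^sub>R pert P"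

definition primal_feasible :: "('n::finite, 'm::finite, 'p::finite) socp \<Rightarrow> (real ^ 'n) set" where
  "primal_feasible P = {x \<in> soc_prod P. coef_mat P *v x = rhs P}"

definition dual_feasible ::
    "('n::finite, 'm::finite, 'p::finite) socp \<Rightarrow> real \<Rightarrow> ((real ^ 'm) \<times> (real ^ 'n)) set" where
  "dual_feasible P \<epsilon> = {(y, s). s \<in> soc_prod P \<and> transpose (coef_mat P) *v y + s = obj P \<epsilon>}"

definition opt_value :: "('n::finite, 'm::finite, 'p::finite) socp \<Rightarrow> real \<Rightarrow> ereal" where
  "opt_value P \<epsilon> = (INF x\<in>primal_feasible P. ereal (obj P \<epsilon> \<bullet> x))"

definition param_domain :: "('n::finite, 'm::finite, 'p::finite) socp \<Rightarrow> real set" where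
  "param_domain P = {\<epsilon>. \<bar>opt_value P \<epsilon>\<bar> \<noteq> \<infinity>}"

definition primal_opt :: "('n::finite, 'm::finite, 'p::finite) socp \<Rightarrow> real \<Rightarrow> (real ^ 'n) set" where
  "primal_opt P \<epsilon> = {x \<in> primal_feasible P. ereal (obj P \<epsilon> \<bullet> x) = opt_value P \<epsilon>}"

definition dual_opt ::
    "('n::finite, 'm::finite, 'p::finite) socp \<Rightarrow> real \<Rightarrow> ((real ^ 'm) \<times> (real ^ 'n)) set" where
  "dual_opt P \<epsilon> = {(y, s) \<in> dual_feasible P \<epsilon>. ereal (rhs P \<bullet> y) = opt_value P \<epsilon>}"

definition strictly_feasible_at_0 :: "('n::finite, 'm::finite, 'p::finite) socp \<Rightarrow> bool" where
  "strictly_feasible_at_0 P \<longleftrightarrow>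
     (\<exists>x y s. x \<in> primal_feasible P \<and> (y, s) \<in> dual_feasible P 0 \<and>
        (\<forall>i. block P i x \<in> soc_int P i \<and> block P i s \<in> soc_int P i))"

definition part_B :: "('n::finite, 'm::finite, 'p::finite) socp \<Rightarrow> real \<Rightarrow> 'p set" where
  "part_B P \<epsilon> = {i. \<exists>x\<in>primal_opt P \<epsilon>. block P i x \<in> soc_int P i}"

definition part_N :: "('n::finite, 'm::finite, 'p::finite) socp \<Rightarrow> real \<Rightarrow> 'p set" where
  "part_N P \<epsilon> = {i. \<exists>(y, s)\<in>dual_opt P \<epsilon>. block P i s \<in> soc_int P i}"

definition part_R :: "('n::finite, 'm::finite, 'p::finite) socp \<Rightarrow> real \<Rightarrow> 'p set" where
  "part_R P \<epsilon> = {i. \<exists>x\<in>primal_opt P \<epsilon>. \<exists>(y, s)\<in>dual_opt P \<epsilon>.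
      block P i x \<in> soc_bd P i - {0} \<and> block P i s \<in> soc_bd P i - {0}}"

definition part_T :: "('n::finite, 'm::finite, 'p::finite) socp \<Rightarrow> real \<Rightarrow> 'p set" where
  "part_T P \<epsilon> = UNIV - (part_B P \<epsilon> \<union> part_N P \<epsilon> \<union> part_R P \<epsilon>)"

definition part_T1 :: "('n::finite, 'm::finite, 'p::finite) socp \<Rightarrow> real \<Rightarrow> 'p set" where
  "part_T1 P \<epsilon> = {i \<in> part_T P \<epsilon>. \<forall>x\<in>primal_opt P \<epsilon>. \<forall>(y, s)\<in>dual_opt P \<epsilon>.
      block P i x = 0 \<and> block P i s = 0}"

definition part_T2 :: "('n::finite, 'm::finite, 'p::finite) socp \<Rightarrow> real \<Rightarrow> 'p set" where
  "part_T2 P \<epsilon> = {i \<in> part_T P \<epsilon>. (\<exists>x\<in>primal_opt P \<epsilon>. block P i x \<in> soc_bd P i - {0}) \<and>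
      (\<forall>(y, s)\<in>dual_opt P \<epsilon>. block P i s = 0)}"

definition part_T3 :: "('n::finite, 'm::finite, 'p::finite) socp \<Rightarrow> real \<Rightarrow> 'p set" where
  "part_T3 P \<epsilon> = {i \<in> part_T P \<epsilon>. (\<exists>(y, s)\<in>dual_opt P \<epsilon>. block P i s \<in> soc_bd P i - {0}) \<and>
      (\<forall>x\<in>primal_opt P \<epsilon>. block P i x = 0)}"

definition optimal_partition ::
    "('n::finite, 'm::finite, 'p::finite) socp \<Rightarrow> real \<Rightarrow>
      'p set \<times> 'p set \<times> 'p set \<times> 'p set \<times> 'p set \<times> 'p set \<times> 'p set" where
  "optimal_partition P \<epsilon> =
     (part_B P \<epsilon>, part_N P \<epsilon>, part_R P \<epsilon>, part_T P \<epsilon>, part_T1 P \<epsilon>, part_T2 P \<epsilon>, part_T3 P \<epsilon>)"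

definition max_complementary ::
    "('n::finite, 'm::finite, 'p::finite) socp \<Rightarrow> real \<Rightarrow>
      real ^ 'n \<Rightarrow> real ^ 'm \<Rightarrow> real ^ 'n \<Rightarrow> bool" where
  "max_complementary P \<epsilon> x y s \<longleftrightarrow>
     x \<in> rel_interior (primal_opt P \<epsilon>) \<and> (y, s) \<in> rel_interior (dual_opt P \<epsilon>)"

definition strictly_complementary ::
    "('n::finite, 'm::finite, 'p::finite) socp \<Rightarrow> real \<Rightarrow>
      real ^ 'n \<Rightarrow> real ^ 'm \<Rightarrow> real ^ 'n \<Rightarrow> bool" where
  "strictly_complementary P \<epsilon> x y s \<longleftrightarrow>
     x \<in> primal_opt P \<epsilon> \<and> (y, s) \<in> dual_opt P \<epsilon> \<and> x + s \<in> interior (soc_prod P)"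

definition ray :: "'a::real_vector \<Rightarrow> 'a set" where
  "ray v = {\<zeta> *\<^sub>R v | \<zeta>. \<zeta> \<ge> 0}"

definition partition_constant_on ::
    "('n::finite, 'm::finite, 'p::finite) socp \<Rightarrow> real set \<Rightarrow> bool" where
  "partition_constant_on P S \<longleftrightarrow>
     (\<forall>\<epsilon>'\<in>S. \<forall>\<epsilon>''\<in>S. optimal_partition P \<epsilon>' = optimal_partition P \<epsilon>'')"

text \<open>
  The rays do not depend on the choice of the maximally complementary solution, which is why all of
  them are quantified over.  The predicate is only used on sets where the optimal partition is
  constant, so that the index sets at \<open>\<epsilon>'\<close> and \<open>\<epsilon>''\<close> agree.
\<close>

definition rays_constant_on ::
    "('n::finite, 'm::finite, 'p::finite) socp \<Rightarrow> real set \<Rightarrow> bool" where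
  "rays_constant_on P S \<longleftrightarrow>
     (\<forall>\<epsilon>'\<in>S. \<forall>\<epsilon>''\<in>S. \<forall>x' y' s' x'' y'' s''.
        max_complementary P \<epsilon>' x' y' s' \<longrightarrow> max_complementary P \<epsilon>'' x'' y'' s'' \<longrightarrow>
        (\<forall>i\<in>part_R P \<epsilon>' \<union> part_T2 P \<epsilon>'. ray (block P i x') = ray (block P i x'')) \<and>
        (\<forall>i\<in>part_R P \<epsilon>' \<union> part_T3 P \<epsilon>'. ray (block P i s') = ray (block P i s'')))"

definition invariant_on :: "('n::finite, 'm::finite, 'p::finite) socp \<Rightarrow> real set \<Rightarrow> bool" where
  "invariant_on P S \<longleftrightarrow>
     S \<subseteq> interior (param_domain P) \<and> partition_constant_on P S \<and> rays_constant_on P S"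

definition invariancy_set :: "('n::finite, 'm::finite, 'p::finite) socp \<Rightarrow> real set \<Rightarrow> bool" where
  "invariancy_set P S \<longleftrightarrow>
     invariant_on P S \<and> (\<forall>S'. invariant_on P S' \<and> S \<subseteq> S' \<longrightarrow> S' = S)"

definition nonlinear_on :: "('n::finite, 'm::finite, 'p::finite) socp \<Rightarrow> real set \<Rightarrow> bool" where
  "nonlinear_on P I \<longleftrightarrow>
     is_interval I \<and> open I \<and> (\<exists>\<epsilon>'\<in>I. \<exists>\<epsilon>''\<in>I. \<epsilon>' \<noteq> \<epsilon>'') \<and>
     I \<subseteq> interior (param_domain P) \<and> partition_constant_on P I \<and> \<not> rays_constant_on P I"

definition nonlinearity_interval ::
    "('n::finite, 'm::finite, 'p::finite) socp \<Rightarrow> real set \<Rightarrow> bool" where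
  "nonlinearity_interval P I \<longleftrightarrow>
     nonlinear_on P I \<and> (\<forall>I'. nonlinear_on P I' \<and> I \<subseteq> I' \<longrightarrow> I' = I)"

text \<open>Painleve-Kuratowski continuity of a set-valued mapping at \<open>a\<close> relative to \<open>\<Gamma>\<close>.\<close>

definition outer_semicontinuous_at ::
    "('a::topological_space \<Rightarrow> 'b::topological_space set) \<Rightarrow> 'a \<Rightarrow> 'a set \<Rightarrow> bool" where
  "outer_semicontinuous_at \<Phi> a \<Gamma> \<longleftrightarrow>
     (\<forall>e x l. (\<forall>k::nat. e k \<in> \<Gamma> \<and> x k \<in> \<Phi> (e k)) \<and> e \<longlonglongrightarrow> a \<and> x \<longlonglongrightarrow> l \<longrightarrow> l \<in> \<Phi> a)"

definition inner_semicontinuous_at ::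
    "('a::topological_space \<Rightarrow> 'b::topological_space set) \<Rightarrow> 'a \<Rightarrow> 'a set \<Rightarrow> bool" where
  "inner_semicontinuous_at \<Phi> a \<Gamma> \<longleftrightarrow>
     (\<forall>l\<in>\<Phi> a. \<forall>e. (\<forall>k::nat. e k \<in> \<Gamma>) \<and> e \<longlonglongrightarrow> a \<longrightarrow>
        (\<exists>x. (\<forall>k. x k \<in> \<Phi> (e k)) \<and> x \<longlonglongrightarrow> l))"

definition set_continuous_at ::
    "('a::topological_space \<Rightarrow> 'b::topological_space set) \<Rightarrow> 'a \<Rightarrow> 'a set \<Rightarrow> bool" where
  "set_continuous_at \<Phi> a \<Gamma> \<longleftrightarrow>
     a \<in> \<Gamma> \<and> outer_semicontinuous_at \<Phi> a \<Gamma> \<and> inner_semicontinuous_at \<Phi> a \<Gamma>"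

end

theory Submission
  imports Defs
begin

text \<open>
  Strict complementarity at \<open>\<epsilon>\<close> forces every block into exactly one of the classes \<open>\<B>\<close>, \<open>\<N>\<close>,
  \<open>\<R>\<close>, so that \<open>\<T>\<close> is empty there.  Membership in each of these three classes is witnessed by
  optimal solutions satisfying open conditions: being interior for \<open>\<B>\<close> and \<open>\<N>\<close>, and being nonzero
  for \<open>\<R>\<close>, because complementarity pushes two nonzero blocks onto the boundary by itself
  (\<open>nonzero_blocks_in_part_R\<close>).  Inner semicontinuity carries such witnesses to all nearby
  parameters, so the three classes can only grow near \<open>\<epsilon>\<close>
  (\<open>eventually_parts_grow\<close>).  At every parameter they are pairwise disjoint, again by
  complementarity, and at \<open>\<epsilon>\<close> they already exhaust the blocks; hence they cannot grow properly, and
  the whole optimal partition is locally constant (\<open>optimal_partition_eqI\<close>).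

  On an open interval around \<open>\<epsilon>\<close> with constant partition the rays must vary, since otherwise that
  interval would be an invariant set strictly larger than \<open>{\<epsilon>}\<close>.  The union of all such intervals
  containing \<open>\<epsilon>\<close> is then the required maximal one (\<open>nonlinear_on_in_nonlinearity_interval\<close>).
\<close>

section \<open>Second-order cone blocks\<close>

lemma block_in_soc_iff:
  assumes "block_structure P"
  shows "block P i x \<in> soc P i \<longleftrightarrow> norm (block_tail P i x) \<le> x $ lead P i"
    and "block P i x \<in> soc_int P i \<longleftrightarrow> norm (block_tail P i x) < x $ lead P i"
    and "block P i x \<in> soc_bd P i \<longleftrightarrow> norm (block_tail P i x) = x $ lead P i"
proof -
  have "block_tail P i (block P i x) = block_tail P i x"
    by (simp add: block_tail_def block_def vec_eq_iff)
  moreover have "block P i x $ lead P i = x $ lead P i"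
    using assms by (simp add: block_def block_structure_def)
  ultimately show "block P i x \<in> soc P i \<longleftrightarrow> norm (block_tail P i x) \<le> x $ lead P i"
    and "block P i x \<in> soc_int P i \<longleftrightarrow> norm (block_tail P i x) < x $ lead P i"
    and "block P i x \<in> soc_bd P i \<longleftrightarrow> norm (block_tail P i x) = x $ lead P i"
    by (auto simp: soc_def soc_int_def soc_bd_def)
qed

lemma block_split:
  assumes "block_structure P"
  shows "block P i x = axis (lead P i) (x $ lead P i) + block_tail P i x"
  using assms by (auto simp: vec_eq_iff block_def block_tail_def axis_def block_structure_def)

lemma inner_block:
  assumes "block_structure P"
  shows "block P i x \<bullet> block P i s
    = x $ lead P i * s $ lead P i + block_tail P i x \<bullet> block_tail P i s"
proof -
  have "block_tail P i v $ lead P i = 0" for v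
    by (simp add: block_tail_def)
  then show ?thesis
    by (simp add: block_split[OF assms] inner_add_left inner_add_right inner_axis inner_axis')
qed

lemma inner_eq_sum_blocks: "x \<bullet> s = (\<Sum>i\<in>UNIV. block P i x \<bullet> block P i s)"
proof -
  have "(\<Sum>i\<in>UNIV. block P i x \<bullet> block P i s)
      = (\<Sum>i\<in>UNIV. \<Sum>j\<in>UNIV. if blk P j = i then x $ j * s $ j else 0)"
    by (auto simp: inner_vec_def block_def intro!: sum.cong)
  also have "\<dots> = (\<Sum>j\<in>UNIV. \<Sum>i\<in>UNIV. if blk P j = i then x $ j * s $ j else 0)"
    by (rule sum.swap)
  also have "\<dots> = x \<bullet> s"
    by (simp add: inner_vec_def)
  finally show ?thesis ..
qed

lemma inner_block_lower_bound:
  assumes "block_structure P"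
  shows "x $ lead P i * s $ lead P i - norm (block_tail P i x) * norm (block_tail P i s)
    \<le> block P i x \<bullet> block P i s"
  using norm_cauchy_schwarz[of "- block_tail P i x" "block_tail P i s"]
  by (simp add: inner_block[OF assms])

lemma inner_soc_nonneg:
  assumes "block_structure P" "block P i x \<in> soc P i" "block P i s \<in> soc P i"
  shows "0 \<le> block P i x \<bullet> block P i s"
proof -
  have x: "norm (block_tail P i x) \<le> x $ lead P i" and s: "norm (block_tail P i s) \<le> s $ lead P i"
    using assms by (simp_all add: block_in_soc_iff)
  have "norm (block_tail P i x) * norm (block_tail P i s) \<le> x $ lead P i * s $ lead P i"
    using x s order_trans[OF norm_ge_zero x] by (intro mult_mono) auto
  then show ?thesis
    using inner_block_lower_bound[OF assms(1), of x i s] by linarith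
qed

lemma inner_soc_int_zero_imp_zero:
  assumes P: "block_structure P"
    and x: "block P i x \<in> soc_int P i" and s: "block P i s \<in> soc P i"
    and orth: "block P i x \<bullet> block P i s = 0"
  shows "block P i s = 0"
proof -
  let ?a = "x $ lead P i" and ?b = "s $ lead P i"
    and ?u = "norm (block_tail P i x)" and ?v = "norm (block_tail P i s)"
  have ua: "?u < ?a" and vb: "?v \<le> ?b"
    using x s P by (simp_all add: block_in_soc_iff)
  have b0: "0 \<le> ?b"
    using vb order_trans norm_ge_zero by blast
  have "?a * ?b \<le> ?u * ?v"
    using inner_block_lower_bound[OF P, of x i s] orth by simp
  also have "?u * ?v \<le> ?u * ?b"
    using vb by (simp add: mult_left_mono)
  finally have "(?a - ?u) * ?b \<le> 0"
    by (simp add: algebra_simps)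
  with ua b0 have "?b = 0"
    by (simp add: mult_le_0_iff)
  moreover from this vb have "block_tail P i s = 0"
    by simp
  ultimately show ?thesis
    by (simp add: block_split[OF P])
qed

text \<open>
  A small step along the negative leading axis stays in the cone and leaves the tail unchanged,
  which yields the strict inequality.
\<close>

lemma interior_soc_prod_imp_soc_int:
  assumes P: "block_structure P" and z: "z \<in> interior (soc_prod P)"
  shows "block P i z \<in> soc_int P i"
proof -
  obtain r where r: "r > 0" "ball z r \<subseteq> soc_prod P"
    using z by (auto simp: mem_interior)
  define w where "w = z - (r / 2) *\<^sub>R axis (lead P i) 1"
  have "dist z w < r"
    using r by (simp add: w_def dist_norm)
  then have "block P i w \<in> soc P i"
    using r by (auto simp: soc_prod_def)
  moreover have "block_tail P i w = block_tail P i z"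
    by (auto simp: block_tail_def w_def vec_eq_iff axis_def)
  moreover have "w $ lead P i = z $ lead P i - r / 2"
    by (simp add: w_def axis_def)
  ultimately show ?thesis
    using r by (simp add: block_in_soc_iff[OF P])
qed

lemma continuous_on_block: "continuous_on S (block P i)"
proof -
  have "continuous_on S (\<lambda>x. block P i x)"
    unfolding block_def
  proof (intro continuous_intros)
    fix j show "continuous_on S (\<lambda>x. if blk P j = i then x $ j else 0)"
      by (cases "blk P j = i") (auto intro!: continuous_intros)
  qed
  then show ?thesis by simp
qed

lemma open_soc_int: "open (soc_int P i)"
proof -
  have "continuous_on UNIV (\<lambda>x. block_tail P i x)"
    unfolding block_tail_def
  proof (intro continuous_intros)
    fix j show "continuous_on UNIV (\<lambda>v. if blk P j = i \<and> j \<noteq> lead P i then v $ j else 0)"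
      by (cases "blk P j = i \<and> j \<noteq> lead P i") (auto intro!: continuous_intros)
  qed
  then show ?thesis
    unfolding soc_int_def by (intro open_Collect_less continuous_intros)
qed

section \<open>Complementarity and the optimal partition\<close>

lemma primal_opt_in_soc: "x \<in> primal_opt P \<epsilon> \<Longrightarrow> block P i x \<in> soc P i"
  by (simp add: primal_opt_def primal_feasible_def soc_prod_def)

lemma dual_opt_in_soc: "(y, s) \<in> dual_opt P \<epsilon> \<Longrightarrow> block P i s \<in> soc P i"
  by (simp add: dual_opt_def dual_feasible_def soc_prod_def)

text \<open>
  Both optimal sets are defined through the same value, so the duality gap \<open>x \<bullet> s\<close> vanishes
  for every pair; as a sum of nonnegative block products it vanishes block by block.
\<close>

lemma optimal_blocks_orthogonal:
  assumes P: "block_structure P" and x: "x \<in> primal_opt P \<epsilon>" and s: "(y, s) \<in> dual_opt P \<epsilon>"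
  shows "block P i x \<bullet> block P i s = 0"
proof -
  have "ereal (obj P \<epsilon> \<bullet> x) = ereal (rhs P \<bullet> y)"
    using x s by (auto simp: primal_opt_def dual_opt_def)
  then have "obj P \<epsilon> \<bullet> x = (coef_mat P *v x) \<bullet> y"
    using x by (simp add: primal_opt_def primal_feasible_def)
  also have "\<dots> = (transpose (coef_mat P) *v y) \<bullet> x"
    by (metis dot_lmul_matrix inner_commute transpose_matrix_vector)
  also have "transpose (coef_mat P) *v y = obj P \<epsilon> - s"
    using s by (auto simp: dual_opt_def dual_feasible_def algebra_simps)
  finally have "x \<bullet> s = 0"
    by (simp add: inner_diff_left inner_diff_right inner_commute)
  then have "(\<Sum>i\<in>UNIV. block P i x \<bullet> block P i s) = 0"
    by (simp flip: inner_eq_sum_blocks)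
  moreover have "0 \<le> block P j x \<bullet> block P j s" for j
    using inner_soc_nonneg[OF P primal_opt_in_soc[OF x] dual_opt_in_soc[OF s]] .
  ultimately show ?thesis
    by (simp add: sum_nonneg_eq_0_iff)
qed

lemma primal_interior_imp_dual_zero:
  assumes "block_structure P" "x \<in> primal_opt P \<epsilon>" "(y, s) \<in> dual_opt P \<epsilon>"
    and "block P i x \<in> soc_int P i"
  shows "block P i s = 0"
  using assms inner_soc_int_zero_imp_zero dual_opt_in_soc optimal_blocks_orthogonal by metis

lemma dual_interior_imp_primal_zero:
  assumes "block_structure P" "x \<in> primal_opt P \<epsilon>" "(y, s) \<in> dual_opt P \<epsilon>"
    and "block P i s \<in> soc_int P i"
  shows "block P i x = 0"
  using assms inner_soc_int_zero_imp_zero primal_opt_in_soc optimal_blocks_orthogonal inner_commute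
  by metis

lemma zero_notin_soc_int: "0 \<notin> soc_int P i"
  by (simp add: soc_int_def)

lemma parts_disjoint:
  assumes "block_structure P"
  shows "part_B P \<epsilon> \<inter> part_N P \<epsilon> = {}"
    and "part_B P \<epsilon> \<inter> part_R P \<epsilon> = {}"
    and "part_N P \<epsilon> \<inter> part_R P \<epsilon> = {}"
proof -
  have primal: "block P i s = 0"
    if "i \<in> part_B P \<epsilon>" "(y, s) \<in> dual_opt P \<epsilon>" for i y s
    using that primal_interior_imp_dual_zero[OF assms] by (auto simp: part_B_def)
  have dual: "block P i x = 0" if "i \<in> part_N P \<epsilon>" "x \<in> primal_opt P \<epsilon>" for i x
    using that dual_interior_imp_primal_zero[OF assms] by (auto simp: part_N_def)
  show "part_B P \<epsilon> \<inter> part_N P \<epsilon> = {}"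
  proof (intro equals0I)
    fix i assume i: "i \<in> part_B P \<epsilon> \<inter> part_N P \<epsilon>"
    then obtain y s where "(y, s) \<in> dual_opt P \<epsilon>" "block P i s \<in> soc_int P i"
      by (auto simp: part_N_def)
    with i primal[of i y s] zero_notin_soc_int show False by fastforce
  qed
  show "part_B P \<epsilon> \<inter> part_R P \<epsilon> = {}"
  proof (intro equals0I)
    fix i assume i: "i \<in> part_B P \<epsilon> \<inter> part_R P \<epsilon>"
    then obtain y s where "(y, s) \<in> dual_opt P \<epsilon>" "block P i s \<noteq> 0"
      by (auto simp: part_R_def)
    with i primal[of i y s] show False by simp
  qed
  show "part_N P \<epsilon> \<inter> part_R P \<epsilon> = {}"
  proof (intro equals0I)
    fix i assume i: "i \<in> part_N P \<epsilon> \<inter> part_R P \<epsilon>"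
    then obtain x where "x \<in> primal_opt P \<epsilon>" "block P i x \<noteq> 0"
      by (auto simp: part_R_def)
    with i dual[of i x] show False by simp
  qed
qed

text \<open>
  An interior block would force its partner to vanish, so nonzero partners are automatically on the
  boundary.  This turns membership in \<open>\<R>\<close>, defined through the non-open condition of lying on the
  boundary, into an open one.
\<close>

lemma nonzero_blocks_in_part_R:
  assumes P: "block_structure P" and x: "x \<in> primal_opt P \<epsilon>" and s: "(y, s) \<in> dual_opt P \<epsilon>"
    and nz: "block P i x \<noteq> 0" "block P i s \<noteq> 0"
  shows "i \<in> part_R P \<epsilon>"
proof -
  have "block P i x \<notin> soc_int P i" "block P i s \<notin> soc_int P i"
    using primal_interior_imp_dual_zero[OF P x s] dual_interior_imp_primal_zero[OF P x s] nz by auto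
  then have "block P i x \<in> soc_bd P i" "block P i s \<in> soc_bd P i"
    using primal_opt_in_soc[OF x, of i] dual_opt_in_soc[OF s, of i]
    by (auto simp: block_in_soc_iff[OF P])
  then show ?thesis
    using x s nz by (auto simp: part_R_def)
qed

lemma strictly_complementary_imp_parts_cover:
  assumes P: "block_structure P" and sc: "strictly_complementary P \<epsilon> x y s"
  shows "part_B P \<epsilon> \<union> part_N P \<epsilon> \<union> part_R P \<epsilon> = UNIV"
proof -
  have x: "x \<in> primal_opt P \<epsilon>" and s: "(y, s) \<in> dual_opt P \<epsilon>"
    and xs: "x + s \<in> interior (soc_prod P)"
    using sc by (auto simp: strictly_complementary_def)
  have "i \<in> part_B P \<epsilon> \<union> part_N P \<epsilon> \<union> part_R P \<epsilon>" for i
  proof (cases "block P i x = 0 \<or> block P i s = 0")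
    case True
    have "block P i x + block P i s \<in> soc_int P i"
    proof -
      have "block P i (x + s) = block P i x + block P i s"
        by (simp add: block_def vec_eq_iff)
      then show ?thesis
        using interior_soc_prod_imp_soc_int[OF P xs, of i] by simp
    qed
    with True have "block P i x \<in> soc_int P i \<or> block P i s \<in> soc_int P i"
      by auto
    then show ?thesis
      using x s by (auto simp: part_B_def part_N_def)
  next
    case False
    then show ?thesis
      using nonzero_blocks_in_part_R[OF P x s] by simp
  qed
  then show ?thesis by blast
qed

text \<open>
  The classes at \<open>\<epsilon>\<close> leave no room for proper growth, because at \<open>\<epsilon>'\<close> they remain disjoint.
\<close>

lemma optimal_partition_eqI:
  assumes "block_structure P"
    and "part_B P \<epsilon> \<union> part_N P \<epsilon> \<union> part_R P \<epsilon> = UNIV"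
    and "part_B P \<epsilon> \<subseteq> part_B P \<epsilon>'" "part_N P \<epsilon> \<subseteq> part_N P \<epsilon>'" "part_R P \<epsilon> \<subseteq> part_R P \<epsilon>'"
  shows "optimal_partition P \<epsilon>' = optimal_partition P \<epsilon>"
proof -
  have "part_B P \<epsilon>' = part_B P \<epsilon>" "part_N P \<epsilon>' = part_N P \<epsilon>" "part_R P \<epsilon>' = part_R P \<epsilon>"
    using assms(2-) parts_disjoint[OF assms(1), of \<epsilon>'] by blast+
  moreover from this have "part_T P \<epsilon>' = {}" "part_T P \<epsilon> = {}"
    using assms(2) by (auto simp: part_T_def)
  ultimately show ?thesis
    by (simp add: optimal_partition_def part_T1_def part_T2_def part_T3_def)
qed

section \<open>Local constancy of the partition\<close>

text \<open>The topological form of inner semicontinuity, obtained from the sequential one.\<close>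

lemma inner_semicontinuous_at_hits_open:
  fixes \<Phi> :: "'a::first_countable_topology \<Rightarrow> 'b::topological_space set"
  assumes isc: "inner_semicontinuous_at \<Phi> a \<Gamma>" and l: "l \<in> \<Phi> a" and U: "open U" "l \<in> U"
    and \<Gamma>: "open \<Gamma>" "a \<in> \<Gamma>"
  shows "eventually (\<lambda>e. \<exists>x\<in>\<Phi> e. x \<in> U) (nhds a)"
proof -
  have "eventually (\<lambda>e. \<exists>x\<in>\<Phi> e. x \<in> U) (inf (nhds a) (principal \<Gamma>))"
  proof (rule sequentially_imp_eventually_nhds_within, intro allI impI)
    fix e :: "nat \<Rightarrow> 'a" assume "(\<forall>k. e k \<in> \<Gamma>) \<and> e \<longlonglongrightarrow> a"
    then obtain x where x: "\<And>k. x k \<in> \<Phi> (e k)" "x \<longlonglongrightarrow> l"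
      using isc l unfolding inner_semicontinuous_at_def by blast
    then have "eventually (\<lambda>k. x k \<in> U) sequentially"
      using U topological_tendstoD by blast
    then show "eventually (\<lambda>k. \<exists>x\<in>\<Phi> (e k). x \<in> U) sequentially"
      by eventually_elim (use x in blast)
  qed
  moreover have "eventually (\<lambda>e. e \<in> \<Gamma>) (nhds a)"
    using \<Gamma> by (simp add: eventually_nhds_in_open)
  ultimately show ?thesis
    by (auto simp: eventually_inf_principal elim: eventually_elim2)
qed

lemma eventually_parts_grow:
  fixes P :: "('n::finite, 'm::finite, 'p::finite) socp"
  assumes P: "block_structure P"
    and pc: "inner_semicontinuous_at (primal_opt P) \<epsilon> \<Gamma>"
    and dc: "inner_semicontinuous_at (dual_opt P) \<epsilon> \<Gamma>"
    and \<Gamma>: "open \<Gamma>" "\<epsilon> \<in> \<Gamma>"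
  shows "eventually (\<lambda>\<epsilon>'. part_B P \<epsilon> \<subseteq> part_B P \<epsilon>' \<and> part_N P \<epsilon> \<subseteq> part_N P \<epsilon>'
    \<and> part_R P \<epsilon> \<subseteq> part_R P \<epsilon>') (nhds \<epsilon>)"
proof -
  \<comment> \<open>Every open condition on an optimal block at \<open>\<epsilon>\<close> can be met at all nearby parameters.\<close>
  have primal: "eventually (\<lambda>\<epsilon>'. \<exists>x\<in>primal_opt P \<epsilon>'. block P i x \<in> V) (nhds \<epsilon>)"
    if "x \<in> primal_opt P \<epsilon>" "open V" "block P i x \<in> V" for x V i
  proof -
    have "open (block P i -` V)"
      using \<open>open V\<close> continuous_on_block by (rule open_vimage)
    from inner_semicontinuous_at_hits_open[OF pc that(1) this _ \<Gamma>] that(3)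
    show ?thesis by simp
  qed
  have dual: "eventually (\<lambda>\<epsilon>'. \<exists>(y, s)\<in>dual_opt P \<epsilon>'. block P i s \<in> V) (nhds \<epsilon>)"
    if "(y, s) \<in> dual_opt P \<epsilon>" "open V" "block P i s \<in> V" for y s V i
  proof -
    have "open ((\<lambda>z :: (real ^ 'm) \<times> (real ^ 'n). block P i (snd z)) -` V)"
      using \<open>open V\<close>
      by (intro open_vimage continuous_on_compose2[OF continuous_on_block[of UNIV]])
        (auto intro!: continuous_intros)
    from inner_semicontinuous_at_hits_open[OF dc that(1) this _ \<Gamma>] that(3)
    show ?thesis by (simp add: case_prod_unfold)
  qed
  have "eventually (\<lambda>\<epsilon>'. \<forall>i\<in>part_B P \<epsilon>. i \<in> part_B P \<epsilon>') (nhds \<epsilon>)"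
  proof (rule eventually_ball_finite, simp, rule ballI)
    fix i assume "i \<in> part_B P \<epsilon>"
    then obtain x where "x \<in> primal_opt P \<epsilon>" "block P i x \<in> soc_int P i"
      by (auto simp: part_B_def)
    from primal[OF this(1) open_soc_int this(2)]
    show "eventually (\<lambda>\<epsilon>'. i \<in> part_B P \<epsilon>') (nhds \<epsilon>)"
      by (simp add: part_B_def)
  qed
  moreover have "eventually (\<lambda>\<epsilon>'. \<forall>i\<in>part_N P \<epsilon>. i \<in> part_N P \<epsilon>') (nhds \<epsilon>)"
  proof (rule eventually_ball_finite, simp, rule ballI)
    fix i assume "i \<in> part_N P \<epsilon>"
    then obtain y s where "(y, s) \<in> dual_opt P \<epsilon>" "block P i s \<in> soc_int P i"
      by (auto simp: part_N_def)
    from dual[OF this(1) open_soc_int this(2)]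
    show "eventually (\<lambda>\<epsilon>'. i \<in> part_N P \<epsilon>') (nhds \<epsilon>)"
      by (simp add: part_N_def)
  qed
  moreover have "eventually (\<lambda>\<epsilon>'. \<forall>i\<in>part_R P \<epsilon>. i \<in> part_R P \<epsilon>') (nhds \<epsilon>)"
  proof (rule eventually_ball_finite, simp, rule ballI)
    fix i assume "i \<in> part_R P \<epsilon>"
    then obtain x y s where xs: "x \<in> primal_opt P \<epsilon>" "(y, s) \<in> dual_opt P \<epsilon>"
      "block P i x \<in> - {0}" "block P i s \<in> - {0}"
      by (auto simp: part_R_def)
    have nz: "open (- {0 :: real ^ 'n})"
      by (simp add: open_Compl)
    show "eventually (\<lambda>\<epsilon>'. i \<in> part_R P \<epsilon>') (nhds \<epsilon>)"
      using primal[OF xs(1) nz xs(3)] dual[OF xs(2) nz xs(4)]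
      by eventually_elim (auto intro: nonzero_blocks_in_part_R[OF P])
  qed
  ultimately show ?thesis
    by eventually_elim blast
qed

section \<open>Nonlinearity intervals\<close>

lemma rays_constant_on_subset: "rays_constant_on P T \<Longrightarrow> S \<subseteq> T \<Longrightarrow> rays_constant_on P S"
  unfolding rays_constant_on_def subset_iff by meson

text \<open>
  Intervals through a common point have an interval as union, and a partition that is constant on
  each of them takes its value at that point throughout; so the union is again nonlinear.
\<close>

lemma nonlinear_on_in_nonlinearity_interval:
  assumes I: "nonlinear_on P I" and a: "a \<in> I"
  shows "\<exists>J. nonlinearity_interval P J \<and> I \<subseteq> J"
proof -
  define F where "F = {J. nonlinear_on P J \<and> a \<in> J}"
  have IF: "I \<in> F" using assms by (simp add: F_def)
  then have sub: "I \<subseteq> \<Union>F" by blast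
  have "connected (\<Union>F)"
    by (rule connected_Union)
      (auto simp: F_def nonlinear_on_def is_interval_connected_1)
  then have 1: "is_interval (\<Union>F)"
    by (simp add: is_interval_connected_1)
  have 2: "open (\<Union>F)"
    by (rule open_Union) (simp add: F_def nonlinear_on_def)
  have "optimal_partition P e = optimal_partition P a" if "e \<in> \<Union>F" for e
    using that by (auto simp: F_def nonlinear_on_def partition_constant_on_def)
  then have 3: "partition_constant_on P (\<Union>F)"
    by (simp add: partition_constant_on_def)
  have 4: "\<Union>F \<subseteq> interior (param_domain P)"
    by (auto simp: F_def nonlinear_on_def)
  have 5: "\<not> rays_constant_on P (\<Union>F)"
    using I rays_constant_on_subset[OF _ sub] by (auto simp: nonlinear_on_def)
  have "\<exists>e\<in>\<Union>F. \<exists>e'\<in>\<Union>F. e \<noteq> e'"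
    using I sub unfolding nonlinear_on_def by (meson subsetD)
  then have "nonlinear_on P (\<Union>F)"
    using 1 2 3 4 5 by (simp add: nonlinear_on_def)
  moreover have "J = \<Union>F" if "nonlinear_on P J" "\<Union>F \<subseteq> J" for J
  proof -
    have "J \<in> F"
      using that a sub by (auto simp: F_def)
    with that(2) show ?thesis by blast
  qed
  ultimately show ?thesis
    using sub unfolding nonlinearity_interval_def by (intro exI[of _ "\<Union>F"]) blast
qed

theorem theorem2:
  fixes P :: "('n::finite, 'm::finite, 'p::finite) socp" and \<epsilon> :: real
  assumes "block_structure P"
    and "rank (coef_mat P) = CARD('m)"
    and "pert P \<noteq> 0"
    and "strictly_feasible_at_0 P"
    and "\<epsilon> \<in> interior (param_domain P)"
    and "invariancy_set P {\<epsilon>}"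
    and "\<exists>x y s. strictly_complementary P \<epsilon> x y s"
    and "set_continuous_at (primal_opt P) \<epsilon> (interior (param_domain P))"
    and "set_continuous_at (dual_opt P) \<epsilon> (interior (param_domain P))"
  shows "\<exists>I. nonlinearity_interval P I \<and> \<epsilon> \<in> I"
proof -
  let ?D = "interior (param_domain P)"
  have cover: "part_B P \<epsilon> \<union> part_N P \<epsilon> \<union> part_R P \<epsilon> = UNIV"
    using strictly_complementary_imp_parts_cover assms(1,7) by blast
  have "eventually (\<lambda>\<epsilon>'. part_B P \<epsilon> \<subseteq> part_B P \<epsilon>' \<and> part_N P \<epsilon> \<subseteq> part_N P \<epsilon>'
      \<and> part_R P \<epsilon> \<subseteq> part_R P \<epsilon>') (nhds \<epsilon>)"
    using assms by (intro eventually_parts_grow[where \<Gamma> = ?D]) (auto simp: set_continuous_at_def)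
  then have "eventually (\<lambda>\<epsilon>'. optimal_partition P \<epsilon>' = optimal_partition P \<epsilon>) (nhds \<epsilon>)"
    by eventually_elim (use optimal_partition_eqI[OF assms(1) cover] in blast)
  moreover have "eventually (\<lambda>\<epsilon>'. \<epsilon>' \<in> ?D) (nhds \<epsilon>)"
    using assms(5) by (simp add: eventually_nhds_in_open)
  ultimately have "eventually (\<lambda>\<epsilon>'. optimal_partition P \<epsilon>' = optimal_partition P \<epsilon> \<and> \<epsilon>' \<in> ?D)
      (nhds \<epsilon>)"
    by (rule eventually_conj)
  then obtain d where d: "d > 0"
    "\<And>\<epsilon>'. \<epsilon>' \<in> ball \<epsilon> d \<Longrightarrow> optimal_partition P \<epsilon>' = optimal_partition P \<epsilon> \<and> \<epsilon>' \<in> ?D"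
    by (auto simp: eventually_nhds_metric dist_commute)
  have part: "partition_constant_on P (ball \<epsilon> d)" and dom: "ball \<epsilon> d \<subseteq> ?D"
    using d(2) unfolding partition_constant_on_def by auto
  have two: "\<epsilon> \<in> ball \<epsilon> d" "\<epsilon> + d / 2 \<in> ball \<epsilon> d" "\<epsilon> \<noteq> \<epsilon> + d / 2"
    using d(1) by (auto simp: dist_real_def)
  have "\<not> rays_constant_on P (ball \<epsilon> d)"
  proof
    assume "rays_constant_on P (ball \<epsilon> d)"
    with part dom have "invariant_on P (ball \<epsilon> d)"
      by (simp add: invariant_on_def)
    then have "ball \<epsilon> d = {\<epsilon>}"
      using assms(6) two(1) unfolding invariancy_set_def by blast
    then show False using two by (metis singletonD)
  qed
  moreover have "\<exists>e\<in>ball \<epsilon> d. \<exists>e'\<in>ball \<epsilon> d. e \<noteq> e'"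
    using two by blast
  ultimately have "nonlinear_on P (ball \<epsilon> d)"
    using part dom by (simp add: nonlinear_on_def is_interval_ball_real)
  with two(1) show ?thesis
    using nonlinear_on_in_nonlinearity_interval by blast
qed

end
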